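(* Let $\mathfrak{a}=\mathfrak{a}(\mathfrak{g};\kappa,\lambda,s)$ be a Lie affgebra over a field $\mathbb{K}$ of characteristic not $2$, with affine Lie bracket $\{-,-\}$, and let $\mathfrak{b}$ be an affine subspace of $\mathfrak{a}$. Then $\mathfrak{b}$ is a left ideaf of $\mathfrak{a}$ if and only if there exist $a\in\mathfrak{b}$ and an ideal $\mathfrak{h}$ of $\mathfrak{g}$ such that $\mathfrak{b}=a+\mathfrak{h}$ and (1) $\lambda(a)+s-a\in\mathfrak{h}$; (2) $(\kappa-\lambda-\mathrm{ad}_a)(\mathfrak{g})\subseteq\mathfrak{h}$; (3) $\lambda(\mathfrak{h})\subseteq\mathfrak{h}$.
   Context: For a Lie algebra $(\mathfrak{g},[-,-])$ over $\mathbb{K}$, linear maps $\kappa,\lambda:\mathfrak{g}\to\mathfrak{g}$ with $\lambda([a,b])=[\lambda(a),b]+[a,\lambda(b)]-[a,\kappa(b)]$ for all $a,b\in\mathfrak{g}$, and $s\in\mathfrak{g}$, the Lie affgebra $\mathfrak{a}(\mathfrak{g};\kappa,\lambda,s)$ is the set $\mathfrak{g}$ with its affine space structure $\langle a,b,c\rangle=a-b+c$, $\alpha\triangleright_a b=(1-\alpha)a+\alpha b$, and the affine Lie bracket $\{a,b\}=[a,b]+\kappa(a)+\lambda(b-a)+s$. Here $\mathrm{ad}_a(x)=[a,x]$. Affine subspaces are non-empty. A left ideaf of $\mathfrak{a}$ is an affine subspace $\mathfrak{b}$ such that $\{x,b\}\in\mathfrak{b}$ for all $x\in\mathfrak{a}$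 and $b\in\mathfrak{b}$. *)

theory Defs
  imports Complex_Main
begin

text \<open>
  The carrier of a Lie algebra, and of a Lie affgebra, is the whole type \<^typ>\<open>'v\<close>; the vector space
  structure over the field \<^typ>\<open>'k\<close> is the scalar multiplication of a \<^locale>\<open>vector_space\<close>, so that
  its dimension may be infinite. The bracket is alternating rather than merely antisymmetric.
\<close>

locale lie_algebra = vector_space scale
  for scale :: "'k::field \<Rightarrow> 'v::ab_group_add \<Rightarrow> 'v" +
  fixes br :: "'v \<Rightarrow> 'v \<Rightarrow> 'v"
  assumes linear_br_left: "Vector_Spaces.linear scale scale (\<lambda>a. br a b)"
    and linear_br_right: "Vector_Spaces.linear scale scale (\<lambda>b. br a b)"
    and br_self: "br a a = 0"
    and jacobi: "br a (br b c) + br b (br c a) + br c (br a b) = 0"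

definition ad :: "('v \<Rightarrow> 'v \<Rightarrow> 'v) \<Rightarrow> 'v \<Rightarrow> 'v \<Rightarrow> 'v"
  where "ad br a = (\<lambda>x. br a x)"

definition lie_ideal ::
  "('k::field \<Rightarrow> 'v::ab_group_add \<Rightarrow> 'v) \<Rightarrow> ('v \<Rightarrow> 'v \<Rightarrow> 'v) \<Rightarrow> 'v set \<Rightarrow> bool"
  where "lie_ideal scale br h \<longleftrightarrow>
    module.subspace scale h \<and> (\<forall>x. \<forall>y\<in>h. br x y \<in> h)"

text \<open>
  \<open>lam\<close> stands for \<open>\<lambda>\<close>. The parameter \<open>s\<close> of a Lie affgebra \<open>\<aa>(\<gg>; \<kappa>, \<lambda>, s)\<close> is an arbitrary
  element of \<open>\<gg>\<close>, so it is not a parameter of the locale and enters only with \<open>aff_bracket\<close>.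
\<close>

locale lie_affgebra = lie_algebra scale br
  for scale :: "'k::field \<Rightarrow> 'v::ab_group_add \<Rightarrow> 'v" and br :: "'v \<Rightarrow> 'v \<Rightarrow> 'v" +
  fixes \<kappa> lam :: "'v \<Rightarrow> 'v"
  assumes linear_kappa: "Vector_Spaces.linear scale scale \<kappa>"
    and linear_lambda: "Vector_Spaces.linear scale scale lam"
    and lambda_br: "lam (br a b) = br (lam a) b + br a (lam b) - br a (\<kappa> b)"

definition aff_bracket ::
  "('v::ab_group_add \<Rightarrow> 'v \<Rightarrow> 'v) \<Rightarrow> ('v \<Rightarrow> 'v) \<Rightarrow> ('v \<Rightarrow> 'v) \<Rightarrow> 'v \<Rightarrow> 'v \<Rightarrow> 'v \<Rightarrow> 'v"
  where "aff_bracket br \<kappa> lam s a b = br a b + \<kappa> a + lam (b - a) + s"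

definition heap_op :: "'v::ab_group_add \<Rightarrow> 'v \<Rightarrow> 'v \<Rightarrow> 'v"
  where "heap_op a b c = a - b + c"

text \<open>\<open>aff_act scale \<alpha> a b\<close> is \<open>\<alpha> \<triangleright>\<^sub>a b\<close>: the base point \<open>a\<close> comes before \<open>b\<close>.\<close>

definition aff_act :: "('k::field \<Rightarrow> 'v::ab_group_add \<Rightarrow> 'v) \<Rightarrow> 'k \<Rightarrow> 'v \<Rightarrow> 'v \<Rightarrow> 'v"
  where "aff_act scale \<alpha> a b = scale (1 - \<alpha>) a + scale \<alpha> b"

definition affine_subspace :: "('k::field \<Rightarrow> 'v::ab_group_add \<Rightarrow> 'v) \<Rightarrow> 'v set \<Rightarrow> bool"
  where "affine_subspace scale B \<longleftrightarrow> B \<noteq> {} \<and>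
    (\<forall>a\<in>B. \<forall>b\<in>B. \<forall>c\<in>B. heap_op a b c \<in> B) \<and>
    (\<forall>\<alpha>. \<forall>a\<in>B. \<forall>b\<in>B. aff_act scale \<alpha> a b \<in> B)"

definition left_ideaf ::
  "('k::field \<Rightarrow> 'v::ab_group_add \<Rightarrow> 'v) \<Rightarrow> ('v \<Rightarrow> 'v \<Rightarrow> 'v) \<Rightarrow> ('v \<Rightarrow> 'v) \<Rightarrow> ('v \<Rightarrow> 'v) \<Rightarrow> 'v
    \<Rightarrow> 'v set \<Rightarrow> bool"
  where "left_ideaf scale br \<kappa> lam s B \<longleftrightarrow>
    affine_subspace scale B \<and> (\<forall>x. \<forall>b\<in>B. aff_bracket br \<kappa> lam s x b \<in> B)"

end

theory Submission
  imports Defs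
begin

text \<open>Write the affine subspace as a + h with h its direction, a linear subspace. Relative to
  the origin a, the bracket of x with a + y splits into a constant, a term linear in x alone, and
  \<open>br x y + lam y\<close>, which vanishes at y = 0 (\<open>aff_bracket_diff\<close>). Since h
  is closed under sums and differences, all values lie in h iff each piece does; evaluating at zero
  separates the pieces. They give conditions (1) and (2), then (3) together with the ideal property,
  as worked out in \<open>left_ideaf_iff_direction\<close>.\<close>

lemma (in lie_algebra) br_add_left: "br (a + b) c = br a c + br b c"
  using linear_br_left[of c] by (simp add: Vector_Spaces.linear_iff)

lemma (in lie_algebra) br_add_right: "br a (b + c) = br a b + br a c"
  using linear_br_right[of a] by (simp add: Vector_Spaces.linear_iff)

lemma (in lie_algebra) br_zero_left: "br 0 b = 0"
  using br_add_left[of 0 0 b] by simp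

lemma (in lie_algebra) br_zero_right: "br b 0 = 0"
  using br_add_right[of b 0 0] by simp

lemma (in lie_algebra) br_antisym: "br b a = - br a b"
proof -
  have "br a b + br b a = 0"
    using br_self[of "a + b"] unfolding br_add_left br_add_right by (simp add: br_self add.commute)
  then show ?thesis
    by (metis add_eq_0_iff)
qed

text \<open>Terms are grouped by their dependence on x and y. The summand \<open>- ad br a x\<close>
  is \<open>br x a\<close>, rewritten by antisymmetry.\<close>

lemma (in lie_affgebra) aff_bracket_diff:
  "aff_bracket br \<kappa> lam s x (a + y) - a =
    (lam a + s - a) + (\<kappa> x - lam x - ad br a x) + (br x y + lam y)"
proof -
  interpret l: Vector_Spaces.linear scale scale lam by (rule linear_lambda)
  show ?thesis
    by (simp add: aff_bracket_def ad_def br_add_right br_antisym[of x a] l.add l.diff algebra_simps)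
qed

text \<open>Once a is taken as origin, the heap operation with a in the middle is vector addition,
  and the action based at a is scalar multiplication.\<close>

lemma (in vector_space) affine_subspace_direction:
  assumes B: "affine_subspace scale B" and a: "a \<in> B"
  shows "subspace {x. a + x \<in> B}"
proof (rule subspaceI)
  show "0 \<in> {x. a + x \<in> B}"
    using a by simp
next
  fix x y assume "x \<in> {x. a + x \<in> B}" "y \<in> {x. a + x \<in> B}"
  then have "heap_op (a + x) a (a + y) \<in> B"
    using B a unfolding affine_subspace_def by blast
  then show "x + y \<in> {x. a + x \<in> B}"
    by (simp add: heap_op_def algebra_simps)
next
  fix c x assume "x \<in> {x. a + x \<in> B}"
  then have "aff_act scale c a (a + x) \<in> B"
    using B a unfolding affine_subspace_def by blast
  then show "c *s x \<in> {x. a + x \<in> B}"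
    by (simp add: aff_act_def algebra_simps)
qed

text \<open>Here a is fixed and h is only a subspace; that h is an ideal is part of what is derived.
  Hence every base point of a left ideaf satisfies the conditions.\<close>

lemma (in lie_affgebra) left_ideaf_iff_direction:
  assumes B: "affine_subspace scale ((+) a ` h)" and h: "subspace h"
  shows "left_ideaf scale br \<kappa> lam s ((+) a ` h) \<longleftrightarrow>
    lie_ideal scale br h \<and> lam a + s - a \<in> h \<and>
    range (\<lambda>x. \<kappa> x - lam x - ad br a x) \<subseteq> h \<and> lam ` h \<subseteq> h"
    (is "?L \<longleftrightarrow> ?R")
proof -
  interpret k: Vector_Spaces.linear scale scale \<kappa> by (rule linear_kappa)
  interpret l: Vector_Spaces.linear scale scale lam by (rule linear_lambda)
  let ?c = "lam a + s - a" and ?d = "\<lambda>x. \<kappa> x - lam x - ad br a x"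
  have mem: "z \<in> (+) a ` h \<longleftrightarrow> z - a \<in> h" for z
    by (auto simp: image_iff intro!: bexI[of _ "z - a"])
  have L: "?L \<longleftrightarrow> (\<forall>x. \<forall>y\<in>h. ?c + ?d x + (br x y + lam y) \<in> h)"
    using B by (simp add: left_ideaf_def mem aff_bracket_diff)
  show ?thesis
  proof
    assume ?L
    then have *: "?c + ?d x + (br x y + lam y) \<in> h" if "y \<in> h" for x y
      using L that by blast
    \<comment> \<open>The pieces are isolated in turn: x = y = 0 leaves the constant, y = 0 then
      yields the term in x, and subtracting both leaves the mixed term.\<close>
    have c: "?c \<in> h"
      using *[of 0 0] subspace_0[OF h]
      by (simp add: k.zero l.zero ad_def br_zero_right)
    have d: "?d x \<in> h" for x
      using subspace_diff[OF h *[of 0 x] c] subspace_0[OF h]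
      by (simp add: l.zero br_zero_right)
    have bl: "br x y + lam y \<in> h" if "y \<in> h" for x y
      using subspace_diff[OF h *[OF that, of x] subspace_add[OF h c d[of x]]] by simp
    \<comment> \<open>At x = 0 the mixed term is just \<open>lam y\<close>; subtracting it leaves
      \<open>br x y\<close>, which makes h an ideal.\<close>
    have l: "lam y \<in> h" if "y \<in> h" for y
      using bl[OF that, of 0] by (simp add: br_zero_left)
    have "br x y \<in> h" if "y \<in> h" for x y
      using subspace_diff[OF h bl[OF that, of x] l[OF that]] by simp
    with c d l h show ?R
      by (auto simp: lie_ideal_def)
  next
    assume ?R
    then show ?L
      unfolding L lie_ideal_def
      by (intro allI ballI subspace_add[OF h]) auto
  qed
qed

theorem proposition3p1:
  fixes scale :: "'k::field \<Rightarrow> 'v::ab_group_add \<Rightarrow> 'v"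
    and br :: "'v \<Rightarrow> 'v \<Rightarrow> 'v"
    and \<kappa> lam :: "'v \<Rightarrow> 'v" and s :: 'v and B :: "'v set"
  assumes "CHAR('k) \<noteq> 2"
    and "lie_affgebra scale br \<kappa> lam"
    and "affine_subspace scale B"
  shows "left_ideaf scale br \<kappa> lam s B \<longleftrightarrow>
    (\<exists>a\<in>B. \<exists>h. lie_ideal scale br h \<and> B = (\<lambda>x. a + x) ` h \<and>
      lam a + s - a \<in> h \<and>
      (\<lambda>x. \<kappa> x - lam x - ad br a x) ` UNIV \<subseteq> h \<and>
      lam ` h \<subseteq> h)"
    (is "?L \<longleftrightarrow> ?R")
proof -
  interpret lie_affgebra scale br \<kappa> lam by (rule assms(2))
  show ?thesis
  proof
    assume L: ?L
    \<comment> \<open>Any point serves as the base point, with h the translate of \<open>B\<close>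
      by -a.\<close>
    obtain a where a: "a \<in> B"
      using assms(3) by (auto simp: affine_subspace_def)
    define h where "h = {x. a + x \<in> B}"
    have h: "subspace h"
      unfolding h_def by (rule affine_subspace_direction[OF assms(3) a])
    have "b \<in> (+) a ` h" if "b \<in> B" for b
      using that by (intro image_eqI[of _ _ "b - a"]) (simp_all add: h_def)
    then have B: "B = (+) a ` h"
      by (auto simp: h_def)
    show ?R
      using left_ideaf_iff_direction[of a h s] L assms(3) a h B by blast
  next
    assume ?R
    then obtain a h where "lie_ideal scale br h" and B: "B = (+) a ` h"
      and "lam a + s - a \<in> h" "range (\<lambda>x. \<kappa> x - lam x - ad br a x) \<subseteq> h" "lam ` h \<subseteq> h"
      by blast
    then show ?L
      using left_ideaf_iff_direction[of a h s] assms(3) by (simp add: lie_ideal_def)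
  qed
qed

end
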